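(* Let $\Gamma$ be a locally finite graph, $F$ a field with an absolute value $|\cdot|_{\rm v}$, and $\lambda\in F$. If $\Gamma$ has an $(F,\lambda)$-propagator with infinite support with respect to some vertex $v$, then the operator $A_{\Gamma,F}$ has an eigenfunction $f$ with infinite support corresponding to the eigenvalue $\lambda$. If, moreover, $\Gamma$ has no $(F,\lambda)$-propagator with finite support with respect to $v$, then $f$ can be chosen with the additional property that the support of $f$ contains $v$.
   Context: A graph is an undirected graph without loops or multiple edges, with vertex set $V(\Gamma)$; $\Gamma(v)$ is the set of vertices adjacent to $v$. $\Gamma$ is locally finite if every $\Gamma(v)$ is finite (it may be infinite and disconnected). $F^{V(\Gamma)}$ is the $F$-vector space of all functions $V(\Gamma)\to F$, and $A_{\Gamma,F}:F^{V(\Gamma)}\to F^{V(\Gamma)}$ is the linear operator $(A_{\Gamma,F}(f))(v)=\sum_{u\in\Gamma(v)}f(u)$; $E$ is the identity operator. The absolute value may be trivial. An eigenfunction corresponding to the eigenvalue $\lambda$ is a nonzero $f$ with $A_{\Gamma,F}(f)=\lambda f$. The support of $f$ is $\{u: f(u)\neq 0\}$. $\delta_v$ is the function equal to $1$ at $v$ and $0$ elsewhere. An $(F,\lambda)$-propagator of $\Gamma$ with respect to $v$ is any $f\in F^{V(\Gamma)}$ with $(A_{\Gamma,F}-\lambda E)(f)=\delta_v$. *)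

theory Defs
  imports Complex_Main "HOL-Library.FuncSet"
begin

text \<open>Edges are two-element sets of vertices, so there are neither loops nor multiple edges.
  The vertex set may be infinite and the graph need not be connected.\<close>

locale simple_graph =
  fixes V :: "'a set" and E :: "'a set set"
  assumes edges: "e \<in> E \<Longrightarrow> e \<subseteq> V \<and> card e = 2"

definition neighbours :: "'a set set \<Rightarrow> 'a \<Rightarrow> 'a set" where
  "neighbours E v = {u. {u, v} \<in> E}"

locale locally_finite_graph = simple_graph +
  assumes finite_neighbours: "v \<in> V \<Longrightarrow> finite (neighbours E v)"

text \<open>The trivial absolute value (\<open>1\<close> on all nonzero elements) is admitted.\<close>

locale absolute_value =
  fixes av :: "'f::field \<Rightarrow> real"
  assumes nonneg: "av x \<ge> 0"
    and eq_zero_iff: "av x = 0 \<longleftrightarrow> x = 0"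
    and mult: "av (x * y) = av x * av y"
    and triangle: "av (x + y) \<le> av x + av y"

text \<open>The space \<open>F\<^sup>V\<close> is represented by the functions that are \<open>undefined\<close> outside \<open>V\<close>, so that
  equality in \<open>F\<^sup>V\<close> is equality in HOL. Scalars range over a type of class \<open>field\<close>.\<close>

abbreviation functions_on :: "'a set \<Rightarrow> ('a \<Rightarrow> 'f::field) set" where
  "functions_on V \<equiv> V \<rightarrow>\<^sub>E UNIV"

definition adjacency_op :: "'a set \<Rightarrow> 'a set set \<Rightarrow> ('a \<Rightarrow> 'f::field) \<Rightarrow> 'a \<Rightarrow> 'f" where
  "adjacency_op V E f = (\<lambda>v\<in>V. \<Sum>u\<in>neighbours E v. f u)"

definition support_on :: "'a set \<Rightarrow> ('a \<Rightarrow> 'f::field) \<Rightarrow> 'a set" where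
  "support_on V f = {u \<in> V. f u \<noteq> 0}"

definition delta_on :: "'a set \<Rightarrow> 'a \<Rightarrow> 'a \<Rightarrow> 'f::field" where
  "delta_on V v = (\<lambda>u\<in>V. if u = v then 1 else 0)"

definition eigenfunction ::
    "'a set \<Rightarrow> 'a set set \<Rightarrow> 'f::field \<Rightarrow> ('a \<Rightarrow> 'f) \<Rightarrow> bool" where
  "eigenfunction V E lam f \<longleftrightarrow>
     f \<in> functions_on V \<and> f \<noteq> (\<lambda>u\<in>V. 0) \<and>
     adjacency_op V E f = (\<lambda>u\<in>V. lam * f u)"

definition propagator ::
    "'a set \<Rightarrow> 'a set set \<Rightarrow> 'f::field \<Rightarrow> 'a \<Rightarrow> ('a \<Rightarrow> 'f) \<Rightarrow> bool" where
  "propagator V E lam v f \<longleftrightarrow>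
     f \<in> functions_on V \<and>
     (\<lambda>u\<in>V. adjacency_op V E f u - lam * f u) = delta_on V v"

end

theory Submission
  imports Defs "HOL-Library.Function_Algebras"
begin

text \<open>
  Write \<open>B = A - \<lambda>\<close>. Local finiteness makes \<open>B\<close> act on the functions of finite support as well,
  and \<open>F\<^sup>V\<close> is the dual space of these, under the pairing \<open>\<langle>f, g\<rangle> = \<Sum> f u * g u\<close>. As adjacency is
  symmetric, \<open>B\<close> on \<open>F\<^sup>V\<close> is the transpose of \<open>B\<close> on finitely supported functions. Hence
  (\<open>finite_propagator_or_kernel\<close>) either \<open>\<delta>\<^sub>v\<close> lies in the image under \<open>B\<close> of the finitely supported
  functions, that is, there is a propagator of finite support, or a linear functional kills this
  image but not \<open>\<delta>\<^sub>v\<close>, and this functional is a function \<open>f\<close> with \<open>B f = 0\<close> and \<open>f v \<noteq> 0\<close>.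

  Let \<open>p\<close> be a propagator of infinite support. In the first case its difference with a propagator
  of finite support is an eigenfunction of infinite support. In the second case \<open>f\<close> itself has
  infinite support: otherwise \<open>f v = \<langle>f, B p\<rangle> = \<langle>B f, p\<rangle> = 0\<close>
  (\<open>finite_support_kernel_vanishes\<close>).
\<close>

section \<open>Separating a vector from a subspace\<close>

lemma (in vector_space) separating_functional:
  assumes "x \<notin> span S"
  obtains \<phi> where "Vector_Spaces.linear scale (*) \<phi>" "\<And>y. y \<in> S \<Longrightarrow> \<phi> y = 0" "\<phi> x = 1"
proof -
  have "vector_space ((*) :: 'a \<Rightarrow> 'a \<Rightarrow> 'a)"
    by unfold_locales (simp_all add: algebra_simps)
  then interpret vector_space_pair scale "(*) :: 'a \<Rightarrow> 'a \<Rightarrow> 'a"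
    by (simp add: vector_space_pair_def vector_space_axioms)
  obtain B where B: "B \<subseteq> S" "independent B" "S \<subseteq> span B"
    using maximal_independent_subset by blast
  have x: "x \<notin> span B"
    using assms B(1) span_mono by blast
  then have "independent (insert x B)"
    using B(2) independent_insertI by blast
  then obtain \<phi> where \<phi>: "Vector_Spaces.linear scale (*) \<phi>"
      "\<And>y. y \<in> insert x B \<Longrightarrow> \<phi> y = (if y = x then 1 else 0)"
    using linear_independent_extend[of "insert x B" "\<lambda>y. if y = x then 1 else 0"] by blast
  have "\<phi> y = 0" if "y \<in> B" for y
    using \<phi>(2) that x span_base by fastforce
  then have "\<phi> y = 0" if "y \<in> S" for y
    using linear_eq_0_on_span[OF \<phi>(1)] B(3) that by blast
  with \<phi> show ?thesis
    using that by simp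
qed

section \<open>The operator on total functions\<close>

lemma neighbours_sym: "u \<in> neighbours E w \<longleftrightarrow> w \<in> neighbours E u"
  by (simp add: neighbours_def insert_commute)

lemma (in simple_graph) neighbours_subset: "neighbours E u \<subseteq> V"
  using edges by (fastforce simp: neighbours_def)

lemma propagator_iff:
  assumes "p \<in> functions_on V"
  shows "propagator V E lam v p \<longleftrightarrow>
    (\<forall>u\<in>V. (\<Sum>w\<in>neighbours E u. p w) - lam * p u = (if u = v then 1 else 0))"
  using assms unfolding propagator_def adjacency_op_def delta_on_def
  by (auto simp: fun_eq_iff restrict_def)

lemma eigenfunction_iff:
  assumes "f \<in> functions_on V"
  shows "eigenfunction V E lam f \<longleftrightarrow>
    support_on V f \<noteq> {} \<and> (\<forall>u\<in>V. (\<Sum>w\<in>neighbours E u. f w) - lam * f u = 0)"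
proof -
  have "f \<noteq> (\<lambda>u\<in>V. 0) \<longleftrightarrow> support_on V f \<noteq> {}"
    using assms by (auto simp: fun_eq_iff restrict_def support_on_def PiE_def extensional_def)
  moreover have "adjacency_op V E f = (\<lambda>u\<in>V. lam * f u) \<longleftrightarrow>
      (\<forall>u\<in>V. (\<Sum>w\<in>neighbours E u. f w) - lam * f u = 0)"
    unfolding adjacency_op_def by (auto simp: fun_eq_iff restrict_def)
  ultimately show ?thesis
    using assms unfolding eigenfunction_def by blast
qed

lemma sum_fun_apply: "(\<Sum>i\<in>A. f i) x = (\<Sum>i\<in>A. f i x)"
  by (induction A rule: infinite_finite_induct) simp_all

lemma vector_space_pointwise: "vector_space (\<lambda>(c::'f::field) f (x::'a). c * f x)"
  by unfold_locales (simp_all add: fun_eq_iff algebra_simps)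

section \<open>Duality between finitely supported and arbitrary functions\<close>

text \<open>
  The columns \<open>b u\<close> of \<open>A - \<lambda>\<close> span the image of the finitely supported functions. A functional
  killing all of them satisfies, by its values on the unit vectors, exactly the kernel equations:
  \<open>b u\<close> is also the row of \<open>u\<close>, by symmetry.
\<close>

lemma (in locally_finite_graph) finite_propagator_or_kernel:
  fixes lam :: "'f::field"
  assumes "v \<in> V"
  obtains
    (propagator) g where "finite (support_on V g)"
      "\<And>u. u \<in> V \<Longrightarrow> (\<Sum>w\<in>neighbours E u. g w) - lam * g u = (if u = v then 1 else 0)"
  | (kernel) f :: "'a \<Rightarrow> 'f" where "f v = 1"
      "\<And>u. u \<in> V \<Longrightarrow> (\<Sum>w\<in>neighbours E u. f w) - lam * f u = 0"
proof -
  let ?s = "\<lambda>(c::'f) (f::'a \<Rightarrow> 'f) x. c * f x"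
  interpret vector_space ?s
    by (rule vector_space_pointwise)
  define d where "d u = (\<lambda>x::'a. if x = u then 1 else 0 :: 'f)" for u
  define b where "b u = (\<Sum>w\<in>neighbours E u. d w) - ?s lam (d u)" for u
  define B where "B g u = (\<Sum>w\<in>neighbours E u. g w) - lam * g u" for g u
  define W where "W = {h. \<exists>g. finite (support_on V g) \<and> (\<forall>u\<in>V. B g u = h u)}"
  have "subspace W"
  proof (rule subspaceI)
    have "finite (support_on V (\<lambda>_. 0::'f))" "\<forall>u\<in>V. B (\<lambda>_. 0) u = 0"
      by (simp_all add: support_on_def B_def)
    then show "0 \<in> W"
      unfolding W_def zero_fun_def by blast
  next
    fix h k assume "h \<in> W" "k \<in> W"
    then obtain g g' where *: "finite (support_on V g)" "\<forall>u\<in>V. B g u = h u"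
        "finite (support_on V g')" "\<forall>u\<in>V. B g' u = k u"
      unfolding W_def by blast
    have "support_on V (g + g') \<subseteq> support_on V g \<union> support_on V g'"
      by (auto simp: support_on_def)
    moreover have "\<forall>u\<in>V. B (g + g') u = (h + k) u"
      using * by (auto simp: B_def sum.distrib algebra_simps)
    ultimately show "h + k \<in> W"
      unfolding W_def using * by (blast intro: finite_subset)
  next
    fix c h assume "h \<in> W"
    then obtain g where *: "finite (support_on V g)" "\<forall>u\<in>V. B g u = h u"
      unfolding W_def by blast
    have "support_on V (?s c g) \<subseteq> support_on V g"
      by (auto simp: support_on_def)
    moreover have "\<forall>u\<in>V. B (?s c g) u = ?s c h u"
      unfolding B_def using *(2)[unfolded B_def]
      by (metis (no_types, lifting) mult.left_commute right_diff_distrib sum.cong sum_distrib_left)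
    ultimately show "?s c h \<in> W"
      unfolding W_def using * by (blast intro: finite_subset)
  qed
  moreover have "b u \<in> W" if "u \<in> V" for u
  proof -
    have "B (d u) w = b u w" if "w \<in> V" for w
      using finite_neighbours[OF that] finite_neighbours[OF \<open>u \<in> V\<close>] neighbours_sym[of u E w]
      by (simp add: B_def b_def d_def sum_fun_apply)
    moreover have "finite (support_on V (d u))"
      by (rule finite_subset[of _ "{u}"]) (auto simp: support_on_def d_def)
    ultimately show ?thesis
      unfolding W_def by blast
  qed
  ultimately have W: "span (b ` V) \<subseteq> W"
    by (intro span_minimal) auto
  show thesis
  proof (cases "d v \<in> span (b ` V)")
    case True
    then have "d v \<in> W"
      using W by blast
    then show thesis
      using propagator unfolding W_def B_def d_def by blast
  next
    case False
    then obtain \<phi> where \<phi>: "Vector_Spaces.linear ?s (*) \<phi>" "\<And>y. y \<in> b ` V \<Longrightarrow> \<phi> y = 0" "\<phi> (d v) = 1"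
      using separating_functional by blast
    interpret \<phi>: Vector_Spaces.linear ?s "(*)" \<phi>
      by (rule \<phi>(1))
    have "(\<Sum>w\<in>neighbours E u. \<phi> (d w)) - lam * \<phi> (d u) = \<phi> (b u)" for u
      unfolding b_def \<phi>.diff \<phi>.sum \<phi>.scale ..
    then show thesis
      using kernel[of "\<lambda>u. \<phi> (d u)"] \<phi> by simp
  qed
qed

text \<open>
  Moving \<open>A - \<lambda>\<close> across the pairing amounts to exchanging two sums, which finiteness of the support
  of \<open>f\<close> permits; \<open>p\<close> is arbitrary. This is why a kernel function not vanishing at \<open>v\<close> has infinite
  support as soon as any propagator with respect to \<open>v\<close> exists.
\<close>

lemma (in locally_finite_graph) finite_support_kernel_vanishes:
  fixes lam :: "'f::field"
  assumes "v \<in> V" "finite (support_on V f)"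
    and f: "\<And>u. u \<in> V \<Longrightarrow> (\<Sum>w\<in>neighbours E u. f w) - lam * f u = 0"
    and p: "\<And>u. u \<in> V \<Longrightarrow>
      (\<Sum>w\<in>neighbours E u. p w) - lam * p u = (if u = v then 1 else 0)"
  shows "f v = 0"
proof -
  \<comment> \<open>On this finite set the double sum below already sees every neighbour of the support.\<close>
  define T where "T = insert v (support_on V f \<union> (\<Union>u\<in>support_on V f. neighbours E u))"
  have T: "finite T" "T \<subseteq> V" "v \<in> T"
    using assms(1,2) finite_neighbours subsetD[OF neighbours_subset]
    by (auto simp: T_def support_on_def)
  have f_out: "f u = 0" if "u \<in> V" "u \<notin> T" for u
    using that by (auto simp: T_def support_on_def)
  have f_row: "(\<Sum>u\<in>T. if u \<in> neighbours E w then f u else 0) = lam * f w" if "w \<in> T" for w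
  proof -
    have "(\<Sum>u\<in>T. if u \<in> neighbours E w then f u else 0) = (\<Sum>u\<in>T \<inter> neighbours E w. f u)"
      using T by (simp add: sum.inter_restrict)
    also have "\<dots> = (\<Sum>u\<in>neighbours E w. f u)"
    proof (intro sum.mono_neutral_left ballI)
      show "finite (neighbours E w)"
        using T that finite_neighbours by blast
      show "f u = 0" if "u \<in> neighbours E w - T \<inter> neighbours E w" for u
        using that neighbours_subset f_out by blast
    qed blast
    finally show ?thesis
      using f that T by auto
  qed
  have p_row: "f u * (\<Sum>w\<in>T. if w \<in> neighbours E u then p w else 0)
      = f u * (\<Sum>w\<in>neighbours E u. p w)" if "u \<in> T" for u
  proof (cases "f u = 0")
    case False
    then have "neighbours E u \<subseteq> T"
      using that T by (auto simp: T_def support_on_def)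
    then have "T \<inter> neighbours E u = neighbours E u"
      by blast
    then show ?thesis
      using T sum.inter_restrict[of T p "neighbours E u"] by simp
  qed simp
  have "(\<Sum>u\<in>T. f u * (\<Sum>w\<in>neighbours E u. p w))
      = (\<Sum>u\<in>T. f u * (\<Sum>w\<in>T. if w \<in> neighbours E u then p w else 0))"
    by (intro sum.cong) (simp_all only: p_row)
  also have "\<dots> = (\<Sum>u\<in>T. \<Sum>w\<in>T. if w \<in> neighbours E u then f u * p w else 0)"
    by (auto simp: sum_distrib_left intro!: sum.cong)
  also have "\<dots> = (\<Sum>w\<in>T. \<Sum>u\<in>T. if w \<in> neighbours E u then f u * p w else 0)"
    by (rule sum.swap)
  also have "\<dots> = (\<Sum>w\<in>T. p w * (\<Sum>u\<in>T. if u \<in> neighbours E w then f u else 0))"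
    by (auto simp: sum_distrib_left neighbours_sym intro!: sum.cong)
  also have "\<dots> = (\<Sum>w\<in>T. f w * (lam * p w))"
    by (intro sum.cong) (simp_all add: f_row)
  finally have "(\<Sum>u\<in>T. f u * ((\<Sum>w\<in>neighbours E u. p w) - lam * p u)) = 0"
    by (simp add: right_diff_distrib sum_subtractf)
  moreover have "(\<Sum>u\<in>T. f u * ((\<Sum>w\<in>neighbours E u. p w) - lam * p u))
      = (\<Sum>u\<in>T. if u = v then f u else 0)"
    using T(2) by (intro sum.cong) (simp_all add: p subset_iff)
  ultimately show ?thesis
    using T by simp
qed

section \<open>Eigenfunctions of infinite support\<close>

theorem mainTheorem6:
  fixes V :: "'a set" and E :: "'a set set"
    and av :: "'f::field \<Rightarrow> real" and lam :: 'f and v :: 'a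
  assumes "locally_finite_graph V E"
    and "absolute_value av"
    and "v \<in> V"
    and "\<exists>p. propagator V E lam v p \<and> infinite (support_on V p)"
  shows "(\<exists>f. eigenfunction V E lam f \<and> infinite (support_on V f)) \<and>
    ((\<nexists>p. propagator V E lam v p \<and> finite (support_on V p)) \<longrightarrow>
      (\<exists>f. eigenfunction V E lam f \<and> infinite (support_on V f) \<and> v \<in> support_on V f))"
proof -
  interpret locally_finite_graph V E
    by fact
  have restr: "restrict f V \<in> functions_on V" "support_on V (restrict f V) = support_on V f"
      "(\<Sum>w\<in>neighbours E u. restrict f V w) = (\<Sum>w\<in>neighbours E u. f w)" for f :: "'a \<Rightarrow> 'f" and u
    using neighbours_subset[of u]
    by (auto simp: support_on_def restrict_def intro!: sum.cong)
  obtain p where p: "propagator V E lam v p" "infinite (support_on V p)"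
    using assms(4) by blast
  then have p_eq: "\<And>u. u \<in> V \<Longrightarrow>
      (\<Sum>w\<in>neighbours E u. p w) - lam * p u = (if u = v then 1 else 0)"
    using propagator_iff propagator_def by metis
  from assms(3) show ?thesis
  proof (cases rule: finite_propagator_or_kernel[where lam = lam, consumes 1, case_names propagator kernel])
    case (propagator g)
    have "propagator V E lam v (restrict g V)"
      unfolding propagator_iff[OF restr(1)] restr(3) using propagator(2) by simp
    moreover have "finite (support_on V (restrict g V))"
      using propagator(1) by (simp add: restr)
    moreover have "\<exists>f. eigenfunction V E lam f \<and> infinite (support_on V f)"
    proof -
      let ?f = "\<lambda>u. p u - g u"
      have "support_on V p \<subseteq> support_on V ?f \<union> support_on V g"
        by (auto simp: support_on_def)
      then have inf: "infinite (support_on V ?f)"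
        using p(2) propagator(1) finite_subset by blast
      have "(\<Sum>w\<in>neighbours E u. ?f w) - lam * ?f u = 0" if "u \<in> V" for u
        using p_eq[OF that] propagator(2)[OF that]
        by (simp add: sum_subtractf algebra_simps)
      then have "eigenfunction V E lam (restrict ?f V)"
        unfolding eigenfunction_iff[OF restr(1)] restr(2,3) using inf by auto
      then show ?thesis
        using inf restr(2) by metis
    qed
    ultimately show ?thesis
      by blast
  next
    case (kernel f)
    have inf: "infinite (support_on V f)"
      using finite_support_kernel_vanishes[OF assms(3) _ kernel(2) p_eq] kernel(1) by auto
    have v: "v \<in> support_on V f"
      using kernel(1) assms(3) by (simp add: support_on_def)
    have "eigenfunction V E lam (restrict f V)"
      unfolding eigenfunction_iff[OF restr(1)] restr(2,3) using v kernel(2) by auto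
    then show ?thesis
      using inf v restr(2) by metis
  qed
qed

end
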